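(* Let $0<q<1$, let $x,y,a,u,v,\alpha,t$ be complex numbers with $x\ne0$ and $|uxt|<1$, and let the operator $D_q$ act on the variable $x$. Then $$\sum_{n=0}^\infty p_n(x,y,a)\,p_n(u,v,\alpha)\frac{t^n}{(q;q)_n}=\widetilde{E}(a,y;D_q)\left\{\frac{1}{(uxt;q)_\infty}\;{}_1\Phi_1\left(\begin{array}{c}\alpha\\0\end{array}\Big|\,q;vxt\right)\right\}.$$
   Context: For complex $c$: $(c;q)_0=1$, $(c;q)_n=\prod_{i=0}^{n-1}(1-cq^i)$, $(c;q)_\infty=\prod_{i=0}^\infty(1-cq^i)$. The $q$-binomial coefficient is $\left[{n\atop k}\right]_q=\dfrac{(q;q)_n}{(q;q)_k(q;q)_{n-k}}$. The generalized Cauchy polynomials are $$p_n(x,y,a)=\sum_{k=0}^n\left[{n\atop k}\right]_q(-1)^kq^{\binom k2}(a;q)_k\,x^{n-k}y^k.$$ The series ${}_1\Phi_1$ is $${}_1\Phi_1\left(\begin{array}{c}a\\0\end{array}\Big|\,q;z\right)=\sum_{n=0}^\infty(-1)^nq^{\binom n2}\frac{(a;q)_n}{(q;q)_n}z^n.$$ The $q$-derivative acting on the variable $x$ is $D_q\{f(x)\}=\dfrac{f(x)-f(qx)}{x}$ (for $x\ne0$), and $D_q^k$ is its $k$-th iterate. The homogeneous $q$-difference operator is $$\widetilde{E}(a,b;D_q)=\sum_{k=0}^\infty\frac{(-1)^kq^{\binom k2}(a;q)_k}{(q;q)_k}\,b^k D_q^k,$$ i.e. $\widetilde E(a,b;D_q)\{f\}(x)$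 is the sum of the corresponding series of numbers. *)

theory Defs
  imports "HOL-Analysis.Analysis"
begin

definition qpoch :: "complex \<Rightarrow> complex \<Rightarrow> nat \<Rightarrow> complex" where
  "qpoch c q n = (\<Prod>i<n. 1 - c * q ^ i)"

definition qpoch_inf :: "complex \<Rightarrow> complex \<Rightarrow> complex" where
  "qpoch_inf c q = (\<Prod>i. 1 - c * q ^ i)"

definition qbinom :: "complex \<Rightarrow> nat \<Rightarrow> nat \<Rightarrow> complex" where
  "qbinom q n k = qpoch q q n / (qpoch q q k * qpoch q q (n - k))"

text \<open>The generalized Cauchy polynomial \<open>p\<^sub>n(x,y,a)\<close>.\<close>

definition cauchy_poly :: "complex \<Rightarrow> nat \<Rightarrow> complex \<Rightarrow> complex \<Rightarrow> complex \<Rightarrow> complex" where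
  "cauchy_poly q n x y a =
     (\<Sum>k\<le>n. qbinom q n k * (-1) ^ k * q ^ (k choose 2) * qpoch a q k * x ^ (n - k) * y ^ k)"

text \<open>The series \<open>\<^sub>1\<Phi>\<^sub>1\<close> with upper parameter \<open>a\<close>, lower parameter \<open>0\<close>, base \<open>q\<close> and argument \<open>z\<close>.\<close>

definition Phi11_0 :: "complex \<Rightarrow> complex \<Rightarrow> complex \<Rightarrow> complex" where
  "Phi11_0 a q z = (\<Sum>n. (-1) ^ n * q ^ (n choose 2) * qpoch a q n / qpoch q q n * z ^ n)"

text \<open>
  The quotient is the \<open>q\<close>-derivative for \<open>x \<noteq> 0\<close> only. For \<open>x \<noteq> 0\<close> and \<open>q \<noteq> 0\<close> its iterates at
  \<open>x\<close> involve only the points \<open>x, q x, q\<^sup>2 x, \<dots>\<close>, so the value at \<open>0\<close> never enters.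
\<close>

definition qderiv :: "complex \<Rightarrow> (complex \<Rightarrow> complex) \<Rightarrow> complex \<Rightarrow> complex" where
  "qderiv q f x = (f x - f (q * x)) / x"

definition homog_qop_term ::
    "complex \<Rightarrow> complex \<Rightarrow> complex \<Rightarrow> (complex \<Rightarrow> complex) \<Rightarrow> complex \<Rightarrow> nat \<Rightarrow> complex" where
  "homog_qop_term q a b f x k =
     (-1) ^ k * q ^ (k choose 2) * qpoch a q k / qpoch q q k * b ^ k * (qderiv q ^^ k) f x"

text \<open>The homogeneous \<open>q\<close>-difference operator \<open>E(a,b;D\<^sub>q){f}(x)\<close>.\<close>

definition homog_qop ::
    "complex \<Rightarrow> complex \<Rightarrow> complex \<Rightarrow> (complex \<Rightarrow> complex) \<Rightarrow> complex \<Rightarrow> complex" where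
  "homog_qop q a b f x = (\<Sum>k. homog_qop_term q a b f x k)"

text \<open>
  For \<open>|q| < 1\<close> the infinite product and the series above converge for all values of the
  remaining parameters, so \<open>prodinf\<close> and \<open>suminf\<close> denote genuine limits.
\<close>

lemma qpoch_inf_convergent:
  assumes "norm q < 1"
  shows "convergent_prod (\<lambda>i. 1 - c * q ^ i :: complex)"
proof -
  have "summable (\<lambda>i. norm (- c * q ^ i))"
    using assms by (simp add: norm_mult norm_power summable_mult)
  hence "abs_convergent_prod (\<lambda>i. 1 - c * q ^ i)"
    by (simp add: abs_convergent_prod_conv_summable)
  thus ?thesis
    by (rule abs_convergent_prod_imp_convergent_prod)
qed

lemma Phi11_0_summable:
  assumes q: "norm q < 1"
  shows "summable (\<lambda>n. (-1) ^ n * q ^ (n choose 2) * qpoch a q n / qpoch q q n * z ^ n)"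
    (is "summable ?f")
proof -
  have lim: "(\<lambda>n. q ^ n * ((1 - a * q ^ n) / (1 - q * q ^ n)) * z) \<longlonglongrightarrow> 0 * ((1 - a * 0) / (1 - q * 0)) * z"
    by (intro tendsto_intros LIMSEQ_power_zero q) auto
  hence "eventually (\<lambda>n. norm (q ^ n * ((1 - a * q ^ n) / (1 - q * q ^ n)) * z) < 1/2) sequentially"
    using order_tendstoD(2)[OF tendsto_norm_zero, of _ sequentially "1/2"] by simp
  then obtain N where N: "\<And>n. n \<ge> N \<Longrightarrow> norm (q ^ n * ((1 - a * q ^ n) / (1 - q * q ^ n)) * z) < 1/2"
    by (auto simp: eventually_sequentially)
  have rec: "?f (Suc n) = - (q ^ n * ((1 - a * q ^ n) / (1 - q * q ^ n)) * z) * ?f n" for n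
    by (simp add: qpoch_def numeral_2_eq_2 power_add mult_ac)
  show ?thesis
  proof (rule summable_ratio_test[of "1/2" N])
    fix n assume "n \<ge> N"
    show "norm (?f (Suc n)) \<le> 1/2 * norm (?f n)"
      unfolding rec norm_mult[of "- _"] norm_minus_cancel
      using N[OF \<open>n \<ge> N\<close>] by (intro mult_right_mono) auto
  qed auto
qed

end

theory Submission
  imports Defs
begin

text \<open>
  As a function of \<open>z\<close>, the operand of the operator is the generating function
  \<open>\<Sum>n. p\<^sub>n(u,v,\<alpha>) (z t)\<^sup>n / (q;q)\<^sub>n\<close>: it is the Cauchy product of the defining series of
  \<open>\<^sub>1\<Phi>\<^sub>1\<close> with Euler's expansion \<open>1 / (w;q)\<^sub>\<infinity> = \<Sum>n. w\<^sup>n / (q;q)\<^sub>n\<close>, and the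
  coefficient of \<open>z\<^sup>n\<close> is the definition of \<open>p\<^sub>n\<close> up to normalisation.

  The operator \<open>D\<^sub>q\<close> multiplies \<open>z\<^sup>n\<close> by \<open>(1 - q\<^sup>n) / z\<close>, so its \<open>k\<close>-th iterate turns \<open>z\<^sup>n\<close> into
  \<open>(q;q)\<^sub>n / (q;q)\<^bsub>n-k\<^esub> z\<^bsup>n-k\<^esup>\<close> for \<open>k \<le> n\<close> and into \<open>0\<close> for \<open>k > n\<close>. Hence applying the whole
  operator to the single monomial \<open>z\<^sup>n\<close> gives exactly \<open>p\<^sub>n(x,y,a)\<close>, a finite sum, and the theorem
  amounts to exchanging the sum over \<open>k\<close> (the operator) with the sum over \<open>n\<close> (the power series).

  For \<open>0 < q < 1\<close> the factor \<open>(q;q)\<^sub>n / (q;q)\<^bsub>n-k\<^esub>\<close> lies in \<open>[0,1]\<close>. The double series is therefore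
  dominated by the product of two absolutely convergent simple series: the generating function
  at \<open>x\<close>, and a \<open>\<^sub>1\<Phi>\<^sub>1\<close> series at \<open>y / x\<close>. This justifies the exchange.
\<close>

section \<open>Absolute convergence and Euler's expansion\<close>

lemma qpoch_Suc: "qpoch c q (Suc n) = qpoch c q n * (1 - c * q ^ n)"
  by (simp add: qpoch_def)

lemma qpoch_self_nonzero:
  assumes "norm q < 1"
  shows "qpoch q q n \<noteq> 0"
proof -
  have "q * q ^ i \<noteq> 1" for i
  proof
    assume "q * q ^ i = 1"
    hence "norm q ^ Suc i = 1"
      by (metis norm_one norm_power power_Suc)
    thus False
      using power_Suc_le_self[of "norm q" i] assms by simp
  qed
  thus ?thesis
    by (simp add: qpoch_def)
qed

lemma Phi11_0_abs_summable:
  assumes "norm q < 1"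
  shows "summable (\<lambda>n. norm ((-1) ^ n * q ^ (n choose 2) * qpoch a q n / qpoch q q n * z ^ n))"
  by (rule powser_insidea[OF Phi11_0_summable[OF assms, of a "of_real (norm z + 1)"]])
     (simp del: of_real_add)

lemma euler_series_summable:
  assumes q: "norm q < 1" and w: "norm w < 1"
  shows "summable (\<lambda>n. 1 / qpoch q q n * w ^ n)"
proof -
  obtain r where r: "norm w < r" "r < 1"
    using w dense by blast
  have "(\<lambda>n. norm (w / (1 - q * q ^ n))) \<longlonglongrightarrow> norm (w / (1 - q * 0))"
    by (intro tendsto_intros LIMSEQ_power_zero q) auto
  hence "eventually (\<lambda>n. norm (w / (1 - q * q ^ n)) < r) sequentially"
    using r order_tendstoD(2) by fastforce
  then obtain N where N: "\<And>n. n \<ge> N \<Longrightarrow> norm (w / (1 - q * q ^ n)) < r"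
    by (auto simp: eventually_sequentially)
  show ?thesis
  proof (rule summable_ratio_test[of r N])
    fix n assume "n \<ge> N"
    have "1 / qpoch q q (Suc n) * w ^ Suc n = w / (1 - q * q ^ n) * (1 / qpoch q q n * w ^ n)"
      by (simp add: qpoch_Suc)
    thus "norm (1 / qpoch q q (Suc n) * w ^ Suc n) \<le> r * norm (1 / qpoch q q n * w ^ n)"
      using N[OF \<open>n \<ge> N\<close>] by (metis norm_mult mult_right_mono norm_ge_zero less_imp_le)
  qed (use r in auto)
qed

lemma euler_series_abs_summable:
  assumes q: "norm q < 1" and w: "norm w < 1"
  shows "summable (\<lambda>n. norm (1 / qpoch q q n * w ^ n))"
proof -
  obtain r where r: "norm w < r" "r < 1"
    using w dense by blast
  have "norm r < 1"
    using r norm_ge_zero[of w] unfolding real_norm_def by linarith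
  hence "summable (\<lambda>n. 1 / qpoch q q n * complex_of_real r ^ n)"
    by (intro euler_series_summable q) simp
  thus ?thesis
    by (rule powser_insidea) (use r in simp)
qed

text \<open>
  The sum \<open>F(w)\<close> of the series satisfies \<open>F(w) - F(q w) = w F(w)\<close>, since its coefficients satisfy
  \<open>(1 - q\<^bsup>n+1\<^esup>) / (q;q)\<^bsub>n+1\<^esub> = 1 / (q;q)\<^sub>n\<close>. Iterating gives \<open>F(q\<^sup>n w) = (w;q)\<^sub>n F(w)\<close>, and letting
  \<open>n\<close> tend to infinity, continuity of \<open>F\<close> at \<open>0\<close> yields \<open>1 = (w;q)\<^sub>\<infinity> F(w)\<close>.
\<close>

lemma euler_inverse_qpoch_inf:
  assumes q: "norm q < 1" and w: "norm w < 1"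
  shows "(\<lambda>n. 1 / qpoch q q n * w ^ n) sums (1 / qpoch_inf w q)"
proof -
  define F where "F = (\<lambda>z. \<Sum>n. 1 / qpoch q q n * z ^ n)"
  have sums_F: "(\<lambda>n. 1 / qpoch q q n * z ^ n) sums F z" if "norm z < 1" for z
    unfolding F_def by (rule summable_sums[OF euler_series_summable[OF q that]])
  have F0: "F 0 = 1"
    unfolding F_def powser_zero by (simp add: qpoch_def)
  have norm_q_times: "norm (q * z) < 1" if "norm z < 1" for z
    using mult_le_one[of "norm q" "norm z"] q that
    by (metis mult_strict_mono' norm_ge_zero norm_mult mult_1)
  have step: "F (q * z) = (1 - z) * F z" if z: "norm z < 1" for z
  proof -
    let ?g = "\<lambda>n. 1 / qpoch q q n * z ^ n - 1 / qpoch q q n * (q * z) ^ n"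
    have "?g sums (F z - F (q * z))"
      by (intro sums_diff sums_F z norm_q_times)
    moreover have "?g (Suc n) = z * (1 / qpoch q q n * z ^ n)" for n
    proof -
      have "1 - q * q ^ n \<noteq> 0"
        using qpoch_self_nonzero[OF q, of "Suc n"] by (simp add: qpoch_Suc)
      moreover have "z ^ Suc n - (q * z) ^ Suc n = z * z ^ n * (1 - q * q ^ n)"
        by (simp add: power_mult_distrib algebra_simps)
      moreover have "?g (Suc n) = (z ^ Suc n - (q * z) ^ Suc n) / (qpoch q q n * (1 - q * q ^ n))"
        by (simp only: qpoch_Suc diff_divide_distrib times_divide_eq_left mult_1)
      ultimately show ?thesis by simp
    qed
    hence "(\<lambda>n. ?g (Suc n)) sums (z * F z)"
      using sums_mult[OF sums_F[OF z], of z] by simp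
    hence "?g sums (z * F z)"
      by (subst (asm) sums_Suc_iff) simp
    ultimately have "F z - F (q * z) = z * F z"
      by (rule sums_unique2)
    thus ?thesis by (simp add: algebra_simps)
  qed
  have iter: "norm (q ^ n * w) < 1 \<and> F (q ^ n * w) = qpoch w q n * F w" for n
  proof (induction n)
    case 0
    show ?case using w by (simp add: qpoch_def)
  next
    case (Suc n)
    thus ?case
      using step[of "q ^ n * w"] norm_q_times[of "q ^ n * w"]
      by (simp add: qpoch_Suc mult_ac)
  qed
  have "isCont F 0"
    unfolding F_def
    by (rule isCont_powser[OF euler_series_summable[OF q, of "1/2"]]) auto
  moreover have "(\<lambda>n. q ^ n * w) \<longlonglongrightarrow> 0 * w"
    by (intro tendsto_intros LIMSEQ_power_zero q)
  ultimately have "(\<lambda>n. F (q ^ n * w)) \<longlonglongrightarrow> 1"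
    using isCont_tendsto_compose[of 0 F] F0 by fastforce
  moreover have "(\<lambda>n. qpoch w q n) \<longlonglongrightarrow> qpoch_inf w q"
    unfolding qpoch_def qpoch_inf_def
    using convergent_prod_LIMSEQ[OF qpoch_inf_convergent[OF q, of w]]
    by (subst LIMSEQ_lessThan_iff_atMost)
  hence "(\<lambda>n. F (q ^ n * w)) \<longlonglongrightarrow> qpoch_inf w q * F w"
    using iter by (simp add: tendsto_intros)
  ultimately have "qpoch_inf w q * F w = 1"
    using LIMSEQ_unique by blast
  hence "F w = 1 / qpoch_inf w q"
    by (metis mult_zero_left nonzero_eq_divide_eq mult.commute zero_neq_one)
  thus ?thesis using sums_F[OF w] by simp
qed

section \<open>The generating function of the generalized Cauchy polynomials\<close>

lemma cauchy_poly_generating_function: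
  assumes q: "norm q < 1" and us: "norm (u * s) < 1"
  shows "(\<lambda>n. cauchy_poly q n u v \<alpha> / qpoch q q n * s ^ n) sums
           (1 / qpoch_inf (u * s) q * Phi11_0 \<alpha> q (v * s))"
proof -
  let ?a = "\<lambda>n. (-1) ^ n * q ^ (n choose 2) * qpoch \<alpha> q n / qpoch q q n * (v * s) ^ n"
  let ?b = "\<lambda>n. 1 / qpoch q q n * (u * s) ^ n"
  have "(\<lambda>n. \<Sum>k\<le>n. ?a k * ?b (n - k)) sums (suminf ?a * suminf ?b)"
    by (rule Cauchy_product_sums[OF Phi11_0_abs_summable[OF q] euler_series_abs_summable[OF q us]])
  moreover have "suminf ?b = 1 / qpoch_inf (u * s) q"
    using euler_inverse_qpoch_inf[OF q us] by (simp add: sums_iff)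
  moreover have "(\<Sum>k\<le>n. ?a k * ?b (n - k)) = cauchy_poly q n u v \<alpha> / qpoch q q n * s ^ n" for n
    unfolding cauchy_poly_def sum_divide_distrib sum_distrib_right
  proof (rule sum.cong[OF refl])
    fix k assume "k \<in> {..n}"
    hence "s ^ n = s ^ k * s ^ (n - k)"
      by (simp flip: power_add)
    thus "?a k * ?b (n - k) = qbinom q n k * (-1) ^ k * q ^ (k choose 2) * qpoch \<alpha> q k *
            u ^ (n - k) * v ^ k / qpoch q q n * s ^ n"
      using qpoch_self_nonzero[OF q] by (simp add: qbinom_def power_mult_distrib field_simps)
  qed
  ultimately show ?thesis
    by (simp add: Phi11_0_def mult.commute)
qed

section \<open>Iterated q-derivatives of power series\<close>

text \<open>
  This is \<open>(q;q)\<^sub>n / (q;q)\<^bsub>n-k\<^esub>\<close> for \<open>k \<le> n\<close>. Because subtraction of natural numbers truncates, for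
  \<open>k > n\<close> the product contains the factor \<open>1 - q\<^sup>0\<close> and vanishes, just as the \<open>k\<close>-th
  \<open>q\<close>-derivative of \<open>z\<^sup>n\<close> does; no case distinction on \<open>k \<le> n\<close> is then needed in the series below.
\<close>

definition qfalling :: "'a::comm_ring_1 \<Rightarrow> nat \<Rightarrow> nat \<Rightarrow> 'a" where
  "qfalling q n k = (\<Prod>i<k. 1 - q ^ (n - i))"

lemma qfalling_Suc: "qfalling q n (Suc k) = qfalling q n k * (1 - q ^ (n - k))"
  by (simp add: qfalling_def)

lemma qfalling_eq_0: "n < k \<Longrightarrow> qfalling q n k = 0"
  unfolding qfalling_def by (rule prod_zero) (auto intro!: bexI[of _ n])

lemma qfalling_mult_qpoch:
  "k \<le> n \<Longrightarrow> qfalling q n k * qpoch q q (n - k) = qpoch q q n"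
proof (induction k)
  case 0
  show ?case by (simp add: qfalling_def)
next
  case (Suc k)
  hence "n - k = Suc (n - Suc k)" by simp
  hence "qpoch q q (n - k) = qpoch q q (n - Suc k) * (1 - q ^ (n - k))"
    by (simp add: qpoch_Suc)
  with Suc show ?case by (simp add: qfalling_Suc mult_ac)
qed

lemma norm_qfalling_le_1:
  fixes q :: real
  assumes "0 \<le> q" "q \<le> 1"
  shows "norm (qfalling (complex_of_real q) n k) \<le> 1"
proof -
  have "qfalling (complex_of_real q) n k = of_real (qfalling q n k)"
    by (simp add: qfalling_def)
  moreover have "0 \<le> qfalling q n k" "qfalling q n k \<le> 1"
    unfolding qfalling_def using assms by (auto intro!: prod_nonneg prod_le_1 power_le_one)
  ultimately show ?thesis by simp
qed

text \<open>
  The set \<open>A\<close> only has to be stable under \<open>z \<mapsto> q z\<close> and avoid \<open>0\<close>, because \<open>D\<^sub>q\<close> samples a function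
  at \<open>z\<close> and \<open>q z\<close> and divides by \<open>z\<close>.
\<close>

lemma qderiv_iterate_power_series:
  assumes sums_f: "\<And>z. z \<in> A \<Longrightarrow> (\<lambda>n. C n * z ^ n) sums f z"
    and A: "0 \<notin> A" "\<And>z. z \<in> A \<Longrightarrow> q * z \<in> A"
    and z: "z \<in> A"
  shows "(\<lambda>n. C n * qfalling q n k * z ^ (n - k)) sums (qderiv q ^^ k) f z"
  using z
proof (induction k arbitrary: z)
  case 0
  thus ?case using sums_f by (simp add: qfalling_def)
next
  case (Suc k)
  have "z \<noteq> 0" using Suc.prems A by auto
  have "(\<lambda>n. (C n * qfalling q n k * z ^ (n - k) - C n * qfalling q n k * (q * z) ^ (n - k)) / z)
          sums (((qderiv q ^^ k) f z - (qderiv q ^^ k) f (q * z)) / z)"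
    by (intro sums_divide sums_diff Suc.IH Suc.prems A)
  moreover have "(C n * qfalling q n k * z ^ (n - k) - C n * qfalling q n k * (q * z) ^ (n - k)) / z
      = C n * qfalling q n (Suc k) * z ^ (n - Suc k)" for n
  proof (cases "k < n")
    case True
    hence "z ^ (n - k) = z * z ^ (n - Suc k)"
      by (metis Suc_diff_Suc power_Suc)
    thus ?thesis
      using \<open>z \<noteq> 0\<close> by (simp add: qfalling_Suc power_mult_distrib field_simps)
  next
    case False
    thus ?thesis by (simp add: qfalling_eq_0)
  qed
  ultimately show ?case by (simp add: qderiv_def[of q "(qderiv q ^^ k) f" z])
qed

section \<open>Exchanging the operator with the power series\<close>

text \<open>
  The product bound makes \<open>W\<close> unconditionally summable over all pairs of indices, and the row sums
  and the column sums then both add up to the sum over the pairs.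
\<close>

lemma sums_exchange_dominated:
  fixes W :: "nat \<Rightarrow> nat \<Rightarrow> 'a::banach"
  assumes a: "summable a" and b: "summable b"
    and nonneg: "\<And>n. 0 \<le> a n" "\<And>k. 0 \<le> b k"
    and bound: "\<And>n k. norm (W n k) \<le> a n * b k"
    and rows: "\<And>n. (\<lambda>k. W n k) sums R n"
    and cols: "\<And>k. (\<lambda>n. W n k) sums S k"
  shows "summable S \<and> R sums suminf S"
proof -
  let ?W = "\<lambda>(n, k). W n k"
  have a': "(a has_sum suminf a) UNIV" and b': "(b has_sum suminf b) UNIV"
    using a b nonneg by (auto intro!: norm_summable_imp_has_sum summable_sums)
  have "(\<lambda>(n, k). a n * b k) summable_on UNIV \<times> UNIV"
    by (rule summable_on_SigmaI[where g = "\<lambda>n. a n * suminf b"])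
       (use a' b' nonneg in \<open>auto intro!: has_sum_cmult_right summable_on_cmult_left
          dest: has_sum_imp_summable\<close>)
  hence "(\<lambda>p. norm (?W p)) summable_on UNIV \<times> UNIV"
    by (rule Infinite_Sum.abs_summable_on_comparison_test') (use bound in auto)
  hence "?W summable_on UNIV \<times> UNIV"
    by (rule abs_summable_summable)
  then obtain T where T: "(?W has_sum T) (UNIV \<times> UNIV)"
    by (auto simp: summable_on_def)
  have row_sum: "((\<lambda>k. W n k) has_sum R n) UNIV" for n
    by (rule norm_summable_imp_has_sum[OF summable_comparison_test'[OF summable_mult[OF b, of "a n"]] rows])
       (use bound in simp)
  have col_sum: "((\<lambda>n. W n k) has_sum S k) UNIV" for k
    by (rule norm_summable_imp_has_sum[OF summable_comparison_test'[OF summable_mult2[OF a, of "b k"]] cols])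
       (use bound in simp)
  have "(R has_sum T) UNIV"
    by (rule has_sum_SigmaD[OF T]) (use row_sum in simp)
  moreover have "(S has_sum T) UNIV"
    by (rule has_sum_SigmaD[OF T[THEN has_sum_swap[THEN iffD1]]]) (use col_sum in simp)
  ultimately show ?thesis
    by (metis has_sum_imp_sums sums_iff)
qed

text \<open>
  The hypothesis of absolute convergence at \<open>x\<close> is what makes the double series summable: the
  factor \<open>qfalling\<close> is bounded by \<open>1\<close>, and \<open>x\<^bsup>n-k\<^esup> = x\<^sup>n / x\<^sup>k\<close> on its support, so the term with
  indices \<open>n\<close> and \<open>k\<close> is at most \<open>\<bar>C n x\<^sup>n\<bar>\<close> times the absolute value of the \<open>k\<close>-th term of a \<open>\<^sub>1\<Phi>\<^sub>1\<close> series at \<open>y / x\<close>.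
\<close>

lemma homog_qop_power_series:
  fixes q :: real and f :: "complex \<Rightarrow> complex"
  assumes q: "0 < q" "q < 1"
    and sums_f: "\<And>z::complex. z \<in> A \<Longrightarrow> (\<lambda>n. C n * z ^ n) sums f z"
    and A: "0 \<notin> A" "\<And>z. z \<in> A \<Longrightarrow> of_real q * z \<in> A"
    and x: "x \<in> A"
    and abs_conv: "summable (\<lambda>n. norm (C n * x ^ n))"
  shows "summable (homog_qop_term q a y f x) \<and>
         (\<lambda>n. C n * cauchy_poly q n x y a) sums homog_qop q a y f x"
proof -
  define c where "c = (\<lambda>k. (-1) ^ k * complex_of_real q ^ (k choose 2) * qpoch a q k / qpoch q q k)"
  define W where "W = (\<lambda>n k. c k * y ^ k * (C n * qfalling (of_real q) n k * x ^ (n - k)))"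
  have norm_q: "norm (complex_of_real q) < 1" and "x \<noteq> 0"
    using q x A by auto
  have W_zero: "W n k = 0" if "n < k" for n k
    using that by (simp add: W_def qfalling_eq_0)
  have rows: "(\<lambda>k. W n k) sums (C n * cauchy_poly q n x y a)" for n
  proof -
    have "W n k = C n * (qbinom q n k * (-1) ^ k * of_real q ^ (k choose 2) * qpoch a q k
            * x ^ (n - k) * y ^ k)" if "k \<le> n" for k
      using qfalling_mult_qpoch[OF that, of "complex_of_real q"] qpoch_self_nonzero[OF norm_q]
      by (simp add: W_def c_def qbinom_def field_simps)
    hence "(\<Sum>k\<le>n. W n k) = C n * cauchy_poly q n x y a"
      by (simp add: cauchy_poly_def sum_distrib_left)
    moreover have "(\<lambda>k. W n k) sums (\<Sum>k\<le>n. W n k)"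
      by (rule sums_finite) (use W_zero in auto)
    ultimately show ?thesis by simp
  qed
  have cols: "(\<lambda>n. W n k) sums homog_qop_term q a y f x k" for k
    unfolding W_def homog_qop_term_def c_def
    by (intro sums_mult qderiv_iterate_power_series[OF sums_f A x])
  have bound: "norm (W n k) \<le> norm (C n * x ^ n) * norm (c k * (y / x) ^ k)" for n k
  proof (cases "k \<le> n")
    case True
    hence "x ^ (n - k) = x ^ n / x ^ k"
      using \<open>x \<noteq> 0\<close> by (simp add: power_diff)
    hence "W n k = (C n * x ^ n) * (c k * (y / x) ^ k) * qfalling (of_real q) n k"
      by (simp add: W_def power_divide)
    thus ?thesis
      using norm_qfalling_le_1[of q n k] q
      by (simp add: norm_mult mult_left_le)
  next
    case False
    thus ?thesis by (simp add: W_zero)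
  qed
  have "summable (\<lambda>k. norm (c k * (y / x) ^ k))"
    unfolding c_def by (rule Phi11_0_abs_summable[OF norm_q])
  from sums_exchange_dominated[OF abs_conv this _ _ bound rows cols]
  show ?thesis by (simp add: homog_qop_def[abs_def])
qed

theorem theorem2p5:
  fixes q :: real and x y a u v \<alpha> t :: complex
  assumes "0 < q" and "q < 1"
    and "x \<noteq> 0"
    and "norm (u * x * t) < 1"
  shows "summable (homog_qop_term q a y
            (\<lambda>z. 1 / qpoch_inf (u * z * t) q * Phi11_0 \<alpha> q (v * z * t)) x)
       \<and> (\<lambda>n. cauchy_poly q n x y a * cauchy_poly q n u v \<alpha> * t ^ n / qpoch q q n)
           sums homog_qop q a y
            (\<lambda>z. 1 / qpoch_inf (u * z * t) q * Phi11_0 \<alpha> q (v * z * t)) x"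
proof -
  let ?f = "\<lambda>z. 1 / qpoch_inf (u * z * t) q * Phi11_0 \<alpha> q (v * z * t)"
  let ?C = "\<lambda>n. cauchy_poly q n u v \<alpha> / qpoch q q n * t ^ n"
  define A where "A = {z. z \<noteq> 0 \<and> norm (u * z * t) < 1}"
  have norm_q: "norm (complex_of_real q) < 1"
    using assms by simp
  have sums_f: "(\<lambda>n. ?C n * z ^ n) sums ?f z" if "z \<in> A" for z
    using cauchy_poly_generating_function[OF norm_q, of u "z * t" v \<alpha>] that
    by (simp add: A_def power_mult_distrib mult_ac)
  have A_stable: "of_real q * z \<in> A" if "z \<in> A" for z
  proof -
    have "norm (u * (of_real q * z) * t) = q * norm (u * z * t)"
      using assms by (simp add: norm_mult)
    also have "\<dots> \<le> norm (u * z * t)"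
      using assms by (intro mult_left_le_one_le) auto
    finally show ?thesis using that assms by (simp add: A_def)
  qed
  \<comment> \<open>Absolute convergence at \<open>x\<close> follows from convergence at a point \<open>r x\<close> with \<open>r > 1\<close> that is
      still in \<open>A\<close>. For \<open>p = norm (u x t) < 1\<close>, the value \<open>r = 2 / (1 + p)\<close> exceeds \<open>1\<close> and
      satisfies \<open>r p < 1\<close>, also when \<open>p = 0\<close>.\<close>
  have "summable (\<lambda>n. norm (?C n * x ^ n))"
  proof -
    define r where "r = 2 / (1 + norm (u * x * t))"
    have pos: "0 < 1 + norm (u * x * t)"
      using norm_ge_zero[of "u * x * t"] by linarith
    have "1 < r" "r * norm (u * x * t) < 1"
      using assms(4) pos unfolding r_def by (simp_all add: field_simps)
    moreover have "norm (u * (of_real r * x) * t) = r * norm (u * x * t)"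
      using \<open>1 < r\<close> by (simp add: norm_mult)
    ultimately have "of_real r * x \<in> A" and "norm x < norm (of_real r * x)"
      using \<open>x \<noteq> 0\<close> by (auto simp: A_def norm_mult mult_ac)
    thus ?thesis
      using powser_insidea[OF sums_summable[OF sums_f]] by blast
  qed
  hence "summable (homog_qop_term q a y ?f x) \<and>
         (\<lambda>n. ?C n * cauchy_poly q n x y a) sums homog_qop q a y ?f x"
    by (rule homog_qop_power_series[OF assms(1,2) sums_f _ A_stable, rotated -1])
       (use assms in \<open>auto simp: A_def\<close>)
  thus ?thesis
    by (simp add: mult_ac)
qed

end
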